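(* Let $G$ be a complete multipartite graph with $n$ vertices, and let $p$ be the maximum cardinality of a part of $G$. Then $\chi_{\mathrm{lin}}(G)=\chi_{\mathrm{cen}}(G)=n-p+1$.
   Context: All graphs are finite and simple. A complete multipartite graph is a graph whose vertex set can be partitioned into nonempty parts such that two vertices are adjacent iff they belong to different parts (this partition is unique). A centered coloring of $G$ assigns integers (colors) to vertices so that every connected subgraph contains a vertex whose color is unique in that subgraph; $\chi_{\mathrm{cen}}(G)$ is the minimum number of colors of such a coloring. A linear coloring requires the same only for every path of $G$ (as a subgraph); $\chi_{\mathrm{lin}}(G)$ is the minimum number of colors of a linear coloring. *)

theory Defs
  imports "Graph_Theory.Graph_Theory" "HOL-Library.Disjoint_Sets"
begin

text \<open>
  Finite simple graphs are the symmetric, loop-free digraphs without parallel arcs given by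
  the locale \<^locale>\<open>graph\<close>; an undirected edge is a pair of opposite arcs.
\<close>

definition complete_multipartite :: "('a, 'b) pre_digraph \<Rightarrow> 'a set set \<Rightarrow> bool" where
  "complete_multipartite G P \<longleftrightarrow>
     graph G \<and> partition_on (verts G) P \<and>
     (\<forall>u \<in> verts G. \<forall>v \<in> verts G.
        u \<rightarrow>\<^bsub>G\<^esub> v \<longleftrightarrow> (\<exists>A \<in> P. \<exists>B \<in> P. A \<noteq> B \<and> u \<in> A \<and> v \<in> B))"

definition has_unique_color :: "('a \<Rightarrow> int) \<Rightarrow> 'a set \<Rightarrow> bool" where
  "has_unique_color c S \<longleftrightarrow> (\<exists>v \<in> S. \<forall>w \<in> S. w \<noteq> v \<longrightarrow> c w \<noteq> c v)"

text \<open>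
  The condition \<^term>\<open>graph H\<close> restricts to those sub-digraphs that are undirected graphs.
  Connected graphs are nonempty by the definition of \<^const>\<open>connected\<close>.
\<close>

definition centered_coloring :: "('a, 'b) pre_digraph \<Rightarrow> ('a \<Rightarrow> int) \<Rightarrow> bool" where
  "centered_coloring G c \<longleftrightarrow>
     (\<forall>H. subgraph H G \<and> graph H \<and> connected H \<longrightarrow> has_unique_color c (verts H))"

text \<open>
  A path is given by its nonempty list of pairwise distinct vertices, consecutive ones being
  adjacent; a single vertex is a path.
\<close>

definition linear_coloring :: "('a, 'b) pre_digraph \<Rightarrow> ('a \<Rightarrow> int) \<Rightarrow> bool" where
  "linear_coloring G c \<longleftrightarrow> (\<forall>xs. vpath xs G \<longrightarrow> has_unique_color c (set xs))"

definition centered_chromatic_number :: "('a, 'b) pre_digraph \<Rightarrow> nat" where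
  "centered_chromatic_number G =
     (LEAST k. \<exists>c. centered_coloring G c \<and> card (c ` verts G) = k)"

definition linear_chromatic_number :: "('a, 'b) pre_digraph \<Rightarrow> nat" where
  "linear_chromatic_number G =
     (LEAST k. \<exists>c. linear_coloring G c \<and> card (c ` verts G) = k)"

end

theory Submission
  imports Defs
begin

text \<open>
  Upper bound: give all vertices of a largest part one color and every other vertex a color of
  its own; a connected subgraph inside a part is a single vertex. Lower bound: in a linear
  coloring, two vertices of equal color lie in a common part (else they span a bad edge), and
  two pairs \<open>u, v\<close> and \<open>w, x\<close> of equally colored vertices from different parts would form the
  bad path \<open>u w v x\<close>. So all repetitions of colors occur inside a single part.
\<close>

text \<open>The set \<open>S\<close> is kept independent of \<open>xs\<close>, so that the induction
  hypothesis for the tail of the walk speaks of the same induced subgraph.\<close>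

lemma vwalk_reachable_induce_subgraph:
  assumes "wf_digraph G" "vwalk xs G" "set xs \<subseteq> S" "x \<in> set xs"
  shows "hd xs \<rightarrow>\<^sup>*\<^bsub>G \<restriction> S\<^esub> x"
proof -
  interpret H: wf_digraph "G \<restriction> S"
    using assms(1) by (rule wf_digraph.wellformed_induce_subgraph)
  show ?thesis
    using assms(2-)
  proof (induction xs arbitrary: x rule: vwalk_induct)
    case (Base u)
    then show ?case by auto
  next
    case (Cons u v es)
    have "u \<rightarrow>\<^bsub>G \<restriction> S\<^esub> v"
      using Cons.hyps Cons.prems by (auto simp: arcs_ends_conv)
    then show ?case
      using Cons.IH Cons.prems H.adj_reachable_trans by auto
  qed
qed

lemma vpath_induces_connected:
  assumes "graph G" "vpath xs G"
  shows "connected (G \<restriction> set xs)"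
proof -
  interpret G: graph G by fact
  have "vwalk xs G" using assms(2) by auto
  then have "set xs \<subseteq> verts G" "xs \<noteq> []" by auto
  interpret H: sym_digraph "G \<restriction> set xs"
    using \<open>set xs \<subseteq> verts G\<close> by (intro G.induced_graph_imp_graph G.induced_induce)
  have reach: "hd xs \<rightarrow>\<^sup>*\<^bsub>G \<restriction> set xs\<^esub> x" if "x \<in> set xs" for x
    using vwalk_reachable_induce_subgraph[OF G.wf_digraph \<open>vwalk xs G\<close> subset_refl that] .
  show ?thesis
  proof (rule H.connectedI)
    show "verts (G \<restriction> set xs) \<noteq> {}" using \<open>xs \<noteq> []\<close> by simp
  next
    fix u v
    assume "u \<in> verts (G \<restriction> set xs)" "v \<in> verts (G \<restriction> set xs)"
    \<comment> \<open>Both vertices are reachable from the head of the path, and symmetry of the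
      arcs leads from \<open>u\<close> back to the head.\<close>
    then have "u \<rightarrow>\<^sup>*\<^bsub>G \<restriction> set xs\<^esub> v"
      using reach H.symmetric_reachable' H.reachable_trans by (metis induce_subgraph_verts)
    then show "u \<rightarrow>\<^sup>*\<^bsub>mk_symmetric (G \<restriction> set xs)\<^esub> v"
      by (rule H.reachable_mk_symmetricI)
  qed
qed

text \<open>The subgraph induced on the vertices of a path may have more edges than the path, but
  unique colors depend on the vertex set only.\<close>

lemma centered_imp_linear_coloring:
  assumes "graph G" "centered_coloring G c"
  shows "linear_coloring G c"
  unfolding linear_coloring_def
proof (intro allI impI)
  fix xs
  assume path: "vpath xs G"
  interpret G: graph G by fact
  have "set xs \<subseteq> verts G" using path by auto
  then have ind: "induced_subgraph (G \<restriction> set xs) G" by (rule G.induced_induce)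
  interpret D: digraph "G \<restriction> set xs" using ind by (rule G.digraphI_induced)
  interpret S: sym_digraph "G \<restriction> set xs" using ind by (rule G.induced_graph_imp_graph)
  have "graph (G \<restriction> set xs)" by unfold_locales
  moreover have "subgraph (G \<restriction> set xs) G" using ind by (rule induced_imp_subgraph)
  ultimately have "has_unique_color c (verts (G \<restriction> set xs))"
    using assms(2) vpath_induces_connected[OF assms(1) path] unfolding centered_coloring_def
    by blast
  then show "has_unique_color c (set xs)" by simp
qed

text \<open>Since parts are disjoint, \<open>A\<close> is the only part containing \<open>u\<close>,
  so both existential quantifiers collapse to one membership test.\<close>

lemma complete_multipartite_adj_iff:
  assumes "complete_multipartite G P" "A \<in> P" "u \<in> A" "v \<in> verts G"
  shows "u \<rightarrow>\<^bsub>G\<^esub> v \<longleftrightarrow> v \<notin> A"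
proof -
  have part: "partition_on (verts G) P" using assms(1) by (simp add: complete_multipartite_def)
  then have V: "verts G = \<Union>P" and disj: "\<And>B C. B \<in> P \<Longrightarrow> C \<in> P \<Longrightarrow> B \<noteq> C \<Longrightarrow> B \<inter> C = {}"
    by (auto simp: partition_on_def disjoint_def)
  have "u \<in> verts G" using V assms by auto
  then have "u \<rightarrow>\<^bsub>G\<^esub> v \<longleftrightarrow> (\<exists>B \<in> P. \<exists>C \<in> P. B \<noteq> C \<and> u \<in> B \<and> v \<in> C)"
    using assms by (simp add: complete_multipartite_def)
  also have "\<dots> \<longleftrightarrow> v \<notin> A"
    using V disj assms by (metis UnionE disjoint_iff)
  finally show ?thesis .
qed

lemma linear_coloring_adj_neq:
  assumes "graph G" "linear_coloring G c" "u \<rightarrow>\<^bsub>G\<^esub> v"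
  shows "c u \<noteq> c v"
proof
  assume "c u = c v"
  interpret G: graph G by fact
  have "u \<noteq> v" using assms(3) G.adj_not_same by blast
  then have "vpath [u, v] G"
    using G.adj_in_verts[OF assms(3)] assms(3) by (auto simp: vpath_def vwalk_def)
  then have "has_unique_color c {u, v}"
    using assms(2) unfolding linear_coloring_def by fastforce
  then show False
    using \<open>c u = c v\<close> \<open>u \<noteq> v\<close> by (auto simp: has_unique_color_def)
qed

text \<open>As \<open>x\<close> ranges over the vertices of \<open>A\<close> too, no color used
  outside \<open>A\<close> recurs inside it. The lower bound owes its summand 1 to this.\<close>

lemma linear_coloring_repetitions_in_one_part:
  assumes cm: "complete_multipartite G P" and "verts G \<noteq> {}" and lin: "linear_coloring G c"
  obtains A where "A \<in> P"
    "\<And>w x. w \<in> verts G - A \<Longrightarrow> x \<in> verts G \<Longrightarrow> c w = c x \<Longrightarrow> w = x"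
proof -
  have "graph G" and part: "partition_on (verts G) P"
    using cm by (auto simp: complete_multipartite_def)
  interpret G: graph G by fact
  have V: "verts G = \<Union>P" using part by (simp add: partition_on_def)
  note adj = complete_multipartite_adj_iff[OF cm]
  have same_part: "v \<in> A" if "A \<in> P" "u \<in> A" "v \<in> verts G" "c u = c v" for A u v
    using adj[of A u v] that linear_coloring_adj_neq[OF \<open>graph G\<close> lin] by blast
  show thesis
  proof (cases "inj_on c (verts G)")
    case True
    \<comment> \<open>Without repeated colors any part will do.\<close>
    obtain A where "A \<in> P" using V assms(2) by auto
    then show thesis using that[of A] True by (auto dest: inj_onD)
  next
    case False
    then obtain u v where uv: "u \<in> verts G" "v \<in> verts G" "c u = c v" "u \<noteq> v"
      by (auto simp: inj_on_def)
    then obtain A where A: "A \<in> P" "u \<in> A" using V by auto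
    then have "v \<in> A" using same_part uv by blast
    show thesis
    proof (rule that[OF \<open>A \<in> P\<close>], rule ccontr)
      fix w x
      assume wx: "w \<in> verts G - A" "x \<in> verts G" "c w = c x" "w \<noteq> x"
      \<comment> \<open>If \<open>x\<close> were in \<open>A\<close>, then \<open>w\<close>, having
        the same color, would be in \<open>A\<close> as well.\<close>
      then have "x \<notin> A" using same_part[OF A(1), of x w] by auto
      have "u \<rightarrow>\<^bsub>G\<^esub> w" "v \<rightarrow>\<^bsub>G\<^esub> w" "v \<rightarrow>\<^bsub>G\<^esub> x"
        using adj A \<open>v \<in> A\<close> \<open>x \<notin> A\<close> wx by auto
      moreover from this have "w \<rightarrow>\<^bsub>G\<^esub> v" using G.graph_symmetric by blast
      \<comment> \<open>The path alternates between \<open>A\<close> and its complement, so only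
        edges leaving \<open>A\<close> are used. Every color on it occurs at least twice.\<close>
      ultimately have "vpath [u, w, v, x] G"
        using uv wx A \<open>v \<in> A\<close> \<open>x \<notin> A\<close> by (auto simp: vpath_def vwalk_def)
      then have "has_unique_color c (set [u, w, v, x])"
        using lin unfolding linear_coloring_def by blast
      then show False
        using uv wx unfolding has_unique_color_def by auto
    qed
  qed
qed

lemma linear_coloring_card_ge:
  assumes cm: "complete_multipartite G P" and "verts G \<noteq> {}" and lin: "linear_coloring G c"
  shows "card (verts G) - Max (card ` P) + 1 \<le> card (c ` verts G)"
proof -
  have "graph G" and part: "partition_on (verts G) P"
    using cm by (auto simp: complete_multipartite_def)
  interpret G: graph G by fact
  obtain A where A: "A \<in> P"
    and rep: "\<And>w x. w \<in> verts G - A \<Longrightarrow> x \<in> verts G \<Longrightarrow> c w = c x \<Longrightarrow> w = x"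
    using linear_coloring_repetitions_in_one_part[OF assms] by blast
  have AV: "A \<subseteq> verts G" "A \<noteq> {}" and "finite P"
    using A part finite_elements[OF _ part] by (auto simp: partition_on_def)
  then obtain a where a: "a \<in> A" by auto
  \<comment> \<open>The part \<open>A\<close> may be smaller than a largest one; then even more
    vertices outside it need colors of their own.\<close>
  have "card A \<le> Max (card ` P)" using A \<open>finite P\<close> by simp
  then have "card (verts G) - Max (card ` P) + 1 \<le> card (verts G - A) + 1"
    using AV by (simp add: card_Diff_subset finite_subset)
  also have "\<dots> = card (c ` (verts G - A)) + 1"
    using rep by (subst card_image) (auto intro!: inj_onI)
  also have "\<dots> = card (insert (c a) (c ` (verts G - A)))"
  proof -
    have "c a \<notin> c ` (verts G - A)"
      using rep[of _ a] a AV by force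
    then show ?thesis by simp
  qed
  also have "\<dots> \<le> card (c ` verts G)"
    using a AV by (intro card_mono) auto
  finally show ?thesis .
qed

lemma complete_multipartite_centered_coloring:
  assumes cm: "complete_multipartite G P" and A: "A \<in> P"
    and inj: "inj_on c (verts G - A)" and sep: "\<And>a v. a \<in> A \<Longrightarrow> v \<in> verts G - A \<Longrightarrow> c a \<noteq> c v"
  shows "centered_coloring G c"
  unfolding centered_coloring_def
proof (intro allI impI, elim conjE)
  fix H
  assume sub: "subgraph H G" and "graph H" and conn: "connected H"
  interpret H: graph H by fact
  have HV: "verts H \<subseteq> verts G" using sub by auto
  \<comment> \<open>\<open>connected\<close> refers to the symmetric closure; as \<open>H\<close> is
    already symmetric, reachability holds in \<open>H\<close> itself.\<close>
  have sc: "strongly_connected H"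
    using H.sym_arcs conn by (rule H.symmetric_connected_imp_strongly_connected)
  show "has_unique_color c (verts H)"
  proof (cases "verts H \<subseteq> A")
    case True
    obtain u where u: "u \<in> verts H" using sc by (auto simp: strongly_connected_def)
    have "v = u" if v: "v \<in> verts H" for v
    proof -
      have "u \<rightarrow>\<^sup>*\<^bsub>H\<^esub> v" using sc u v by auto
      then show ?thesis
      proof (cases rule: H.converse_reachable_cases)
        case base
        then show ?thesis by simp
      next
        \<comment> \<open>The first arc of a nontrivial walk from \<open>u\<close> would join two
          vertices of \<open>A\<close>.\<close>
        case (step w)
        then have "u \<rightarrow>\<^bsub>G\<^esub> w" using arcs_ends_mono[OF sub] by auto
        moreover have "w \<in> verts H" using step H.adj_in_verts by blast
        ultimately show ?thesis
          using complete_multipartite_adj_iff[OF cm A, of u w] True HV u by auto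
      qed
    qed
    then show ?thesis using u unfolding has_unique_color_def by blast
  next
    case False
    \<comment> \<open>The color of a vertex outside \<open>A\<close> is unique in all of
      \<open>G\<close>, hence in \<open>H\<close>.\<close>
    then obtain v where v: "v \<in> verts H" "v \<notin> A" by auto
    have "c w \<noteq> c v" if "w \<in> verts H" "w \<noteq> v" for w
      using that v HV inj sep[of w v] by (cases "w \<in> A") (auto dest: inj_onD)
    then show ?thesis using v unfolding has_unique_color_def by blast
  qed
qed

lemma complete_multipartite_centered_coloring_exists:
  assumes cm: "complete_multipartite G P" and "verts G \<noteq> {}"
  obtains c where "centered_coloring G c"
    "card (c ` verts G) = card (verts G) - Max (card ` P) + 1"
proof -
  have "graph G" and part: "partition_on (verts G) P"
    using cm by (auto simp: complete_multipartite_def)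
  interpret G: graph G by fact
  have V: "verts G = \<Union>P" using part by (simp add: partition_on_def)
  have "finite P" using finite_elements[OF _ part] by simp
  moreover have "P \<noteq> {}" using V assms(2) by auto
  ultimately have "Max (card ` P) \<in> card ` P" by simp
  then obtain A where A: "A \<in> P" "card A = Max (card ` P)" by auto
  have AV: "A \<subseteq> verts G" "A \<noteq> {}"
    using A part by (auto simp: partition_on_def)
  obtain f :: "'a \<Rightarrow> nat" where f: "inj_on f (verts G)"
    using finite_imp_inj_to_nat_seg[OF G.finite_verts] by blast
  \<comment> \<open>The shift by 1 keeps the injective colors positive and so reserves 0 for
    \<open>A\<close>.\<close>
  define c where "c v = (if v \<in> A then 0 else 1 + int (f v))" for v
  have inj: "inj_on c (verts G - A)"
    using f by (auto simp: inj_on_def c_def)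
  have "centered_coloring G c"
    using cm A(1) inj by (rule complete_multipartite_centered_coloring) (auto simp: c_def)
  moreover have "c ` verts G = insert 0 (c ` (verts G - A))"
    using AV by (auto simp: c_def image_iff)
  then have "card (c ` verts G) = card (c ` (verts G - A)) + 1"
    by (simp add: c_def image_iff)
  then have "card (c ` verts G) = card (verts G) - Max (card ` P) + 1"
    using card_image[OF inj] A AV by (simp add: card_Diff_subset finite_subset)
  ultimately show thesis by (rule that)
qed

theorem theorem4p5:
  fixes G :: "('a, 'b) pre_digraph" and P :: "'a set set" and n p :: nat
  assumes "complete_multipartite G P"
    and "verts G \<noteq> {}"
    and "n = card (verts G)"
    and "p = Max (card ` P)"
  shows "linear_chromatic_number G = centered_chromatic_number G \<and>
         centered_chromatic_number G = n - p + 1"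
proof -
  have "graph G" using assms(1) by (simp add: complete_multipartite_def)
  note lin = centered_imp_linear_coloring[OF this]
  obtain c where c: "centered_coloring G c" "card (c ` verts G) = n - p + 1"
    using complete_multipartite_centered_coloring_exists[OF assms(1,2)] assms(3,4) by blast
  \<comment> \<open>Centered colorings are linear, so this bound serves both minima, and the single
    coloring \<open>c\<close> attains both.\<close>
  have ge: "n - p + 1 \<le> card (d ` verts G)" if "linear_coloring G d" for d
    using linear_coloring_card_ge[OF assms(1,2) that] assms(3,4) by simp
  have "linear_chromatic_number G = n - p + 1"
    unfolding linear_chromatic_number_def using c lin ge by (intro Least_equality) blast+
  moreover have "centered_chromatic_number G = n - p + 1"
    unfolding centered_chromatic_number_def using c lin ge by (intro Least_equality) blast+
  ultimately show ?thesis by simp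
qed

end
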